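(* Let $F$ be a totally real number field of degree $d$, and identify $F$ with a subset of $\mathbb R^d$ via $F\to\mathbb R^{\mathrm{Hom}(F,\mathbb R)}=\mathbb R^d$. Let $l=(l_j)_{1\le j\le d}\in\mathbb R^d$ with $l_d\ge\dots\ge l_1\ge4$, and $f(x)=\prod_{j=1}^d(1+|x_j|)^{-l_j/2}$ for $x\in\mathbb R^d$. For a $\mathbb Z$-lattice $\Lambda\subset\mathbb R^d$ of full rank, put $\theta(\Lambda)=\sum_{b\in\Lambda-\{0\}}f(b)$, let $D(\Lambda)$ be the Euclidean volume of a fundamental domain of $\mathbb R^d/\Lambda$, and $r(\Lambda)=\frac12\min_{b\in\Lambda-\{0\}}\|b\|$. Then for fractional ideals $\Lambda\subset\Lambda_0$ of $F$ (regarded as lattices), $$\theta(\Lambda)\ll\{1+r(\Lambda_0)\}^{dl_d/2}\,D(\Lambda_0)^{-1}\,D(\Lambda)^{(1-l_1/2)/d},$$ with the implied constant independent of $\Lambda$ and $\Lambda_0$. *)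

theory Defs
  imports "HOL-Analysis.Analysis" "HOL-Computational_Algebra.Computational_Algebra"
begin

definition rat_scale :: "rat \<Rightarrow> 'f::field_char_0 \<Rightarrow> 'f" where
  "rat_scale q x = of_rat q * x"

interpretation rat_vs: vector_space rat_scale
  by unfold_locales (simp_all add: rat_scale_def algebra_simps of_rat_add of_rat_mult)

definition number_field :: "'f::field_char_0 itself \<Rightarrow> bool" where
  "number_field _ \<longleftrightarrow> (\<exists>B :: 'f set. finite B \<and> rat_vs.span B = UNIV)"

definition field_degree :: "'f::field_char_0 itself \<Rightarrow> nat" where
  "field_degree _ = rat_vs.dim (UNIV :: 'f set)"

definition field_homs :: "('f::field \<Rightarrow> 'k::field) set" where
  "field_homs = {h. h 1 = 1 \<and> (\<forall>x y. h (x + y) = h x + h y) \<and> (\<forall>x y. h (x * y) = h x * h y)}"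

definition totally_real :: "'f::field_char_0 itself \<Rightarrow> bool" where
  "totally_real _ \<longleftrightarrow> number_field TYPE('f) \<and>
     (\<forall>h \<in> (field_homs :: ('f \<Rightarrow> complex) set). range h \<subseteq> \<real>)"

definition ring_of_integers :: "'f::field_char_0 set" where
  "ring_of_integers = {x. algebraic_int x}"

text \<open>Fractional ideals are nonzero by convention.\<close>

definition fractional_ideal :: "'f::field_char_0 set \<Rightarrow> bool" where
  "fractional_ideal I \<longleftrightarrow>
     0 \<in> I \<and> I \<noteq> {0} \<and>
     (\<forall>x\<in>I. \<forall>y\<in>I. x + y \<in> I) \<and>
     (\<forall>a\<in>ring_of_integers. \<forall>x\<in>I. a * x \<in> I) \<and>
     (\<exists>c\<in>ring_of_integers. c \<noteq> 0 \<and> (\<forall>x\<in>I. c * x \<in> ring_of_integers))"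

definition real_embedding :: "('n \<Rightarrow> 'f \<Rightarrow> real) \<Rightarrow> 'f \<Rightarrow> real ^ 'n" where
  "real_embedding \<sigma> x = (\<chi> j. \<sigma> j x)"

definition weight :: "real ^ 'n \<Rightarrow> real ^ 'n \<Rightarrow> real" where
  "weight l x = (\<Prod>j\<in>UNIV. (1 + \<bar>x $ j\<bar>) powr (- (l $ j) / 2))"

definition theta :: "real ^ 'n \<Rightarrow> (real ^ 'n) set \<Rightarrow> real" where
  "theta l L = infsum (weight l) (L - {0})"

definition fundamental_domain :: "(real ^ 'n) set \<Rightarrow> (real ^ 'n) set \<Rightarrow> bool" where
  "fundamental_domain L P \<longleftrightarrow> P \<in> sets lebesgue \<and> (\<forall>x. \<exists>!b. b \<in> L \<and> x - b \<in> P)"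

text \<open>For a lattice, all measurable fundamental domains have the same measure, so the choice
  made here is immaterial.\<close>

definition covolume :: "(real ^ 'n) set \<Rightarrow> real" where
  "covolume L = measure lebesgue (SOME P. fundamental_domain L P)"

definition packing_radius :: "(real ^ 'n) set \<Rightarrow> real" where
  "packing_radius L = 1 / 2 * (LEAST v. v \<in> norm ` (L - {0}))"

end

theory Submission imports Defs
begin

text \<open>Let \<open>b\<close> be a shortest nonzero vector of a fractional ideal \<open>\<Lambda>\<close>. Since \<open>\<Lambda>\<close> contains
  \<open>b O\<close>, where \<open>O\<close> is the ring of integers, \<open>D(\<Lambda>)\<close> is at most the volume of any box that covers
  \<open>\<real>\<^sup>d\<close> modulo \<open>b O\<close>. The box with half sides \<open>M |b\<^sub>j|\<close> does, for a constant \<open>M\<close> depending only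
  on \<open>F\<close>, hence \<open>D(\<Lambda>) \<lless> r(\<Lambda>)\<^sup>d\<close>.

  The boxes with half side \<open>r(\<Lambda>\<^sub>0)/d\<close> around the points of \<open>\<Lambda>\<^sub>0\<close> are disjoint, and on the box
  around \<open>b \<in> \<Lambda>\<close> the weight \<open>f\<close> is at least \<open>f(b)\<close> divided by the power \<open>d l\<^sub>d/2\<close> of
  \<open>1 + r(\<Lambda>\<^sub>0)\<close>. So \<open>\<theta>(\<Lambda>)\<close> is bounded by that power times \<open>r(\<Lambda>\<^sub>0)\<^sup>-\<^sup>d\<close> times the integral
  of \<open>f\<close> over the points with some coordinate of size at least \<open>r(\<Lambda>)/d\<close>, and this integral is
  \<open>\<lless>\<close> the power \<open>1 - l\<^sub>1/2\<close> of \<open>r(\<Lambda>)\<close>.\<close>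

no_notation fps_nth (infixl \<open>$\<close> 75)

section \<open>Field homomorphisms and integral bases\<close>

lemma field_homs_zero: "h \<in> field_homs \<Longrightarrow> h 0 = 0"
  by (auto simp: field_homs_def) (metis add_cancel_right_left)

lemma field_homs_add: "h \<in> field_homs \<Longrightarrow> h (x + y) = h x + h y"
  by (simp add: field_homs_def)

lemma field_homs_mult: "h \<in> field_homs \<Longrightarrow> h (x * y) = h x * h y"
  by (simp add: field_homs_def)

lemma field_homs_one: "h \<in> field_homs \<Longrightarrow> h 1 = 1"
  by (simp add: field_homs_def)

lemma field_homs_uminus: "h \<in> field_homs \<Longrightarrow> h (- x) = - h x"
  by (metis add.right_inverse eq_neg_iff_add_eq_0 field_homs_add field_homs_zero add.commute)

lemma field_homs_sum: "h \<in> field_homs \<Longrightarrow> h (sum g A) = (\<Sum>a\<in>A. h (g a))"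
  by (induction A rule: infinite_finite_induct) (auto simp: field_homs_zero field_homs_add)

lemma field_homs_power: "h \<in> field_homs \<Longrightarrow> h (x ^ k) = h x ^ k"
  by (induction k) (auto simp: field_homs_one field_homs_mult)

lemma field_homs_eq_0_iff: "h \<in> field_homs \<Longrightarrow> h x = 0 \<longleftrightarrow> x = 0"
  by (metis field_homs_mult field_homs_one field_homs_zero mult_zero_left right_inverse zero_neq_one)

lemma field_homs_of_int:
  assumes "h \<in> field_homs" shows "h (of_int n) = of_int n"
proof -
  have nat: "h (of_nat m) = of_nat m" for m
    using assms by (induction m) (auto simp: field_homs_zero field_homs_one field_homs_add)
  show ?thesis
    using assms by (cases n) (simp_all add: nat field_homs_uminus del: of_nat_Suc)
qed

lemma field_homs_of_rat:
  fixes h :: "'f::field_char_0 \<Rightarrow> 'k::field_char_0"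
  assumes "h \<in> field_homs" shows "h (of_rat q) = of_rat q"
proof (cases q)
  case (Fract a b)
  have "h (of_rat q) * h (of_int b) = h (of_int a)"
    using Fract assms by (simp add: of_rat_rat flip: field_homs_mult)
  then show ?thesis
    using Fract assms by (simp add: of_rat_rat field_homs_of_int field_simps)
qed

text \<open>Dedekind's independence of characters. The relation at \<open>x * y\<close> minus
  \<open>g y\<close> times the relation at \<open>x\<close> no longer involves \<open>g\<close>; its
  coefficients \<open>c h * (h y - g y)\<close> vanish by induction, and \<open>y\<close> is chosen
  with \<open>h y \<noteq> g y\<close>.\<close>

lemma field_homs_independent:
  fixes c :: "('f::field \<Rightarrow> 'k::field) \<Rightarrow> 'k"
  assumes "finite H" "H \<subseteq> field_homs" "\<And>x. (\<Sum>h\<in>H. c h * h x) = 0" "h \<in> H"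
  shows "c h = 0"
  using assms
proof (induction H arbitrary: c h rule: finite_induct)
  case (insert g H)
  have g: "g \<in> field_homs" and H: "H \<subseteq> field_homs" using insert.prems by auto
  have eq: "c g * g x + (\<Sum>h\<in>H. c h * h x) = 0" for x
    using insert.prems(2)[of x] insert.hyps by simp
  have zero: "c h = 0" if "h \<in> H" for h
  proof -
    have "h \<noteq> g" using that insert.hyps by auto
    then obtain y where y: "h y \<noteq> g y" by auto
    have "(\<Sum>h\<in>H. (c h * (h y - g y)) * h x) = 0" for x
    proof -
      have "(\<Sum>h\<in>H. (c h * (h y - g y)) * h x)
          = (\<Sum>h\<in>H. c h * h (x * y)) - g y * (\<Sum>h\<in>H. c h * h x)"
        unfolding sum_distrib_left sum_subtractf[symmetric]
        by (intro sum.cong refl) (use H in \<open>auto simp: field_homs_mult algebra_simps\<close>)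
      also have "\<dots> = - (c g * g (x * y)) - g y * (- (c g * g x))"
        using eq[of x] eq[of "x * y"] by (simp only: add_eq_0_iff)
      also have "\<dots> = 0" using g by (simp add: field_homs_mult algebra_simps)
      finally show ?thesis .
    qed
    from insert.IH[OF H this that] y show ?thesis by simp
  qed
  have "c g = 0"
    using eq[of 1] zero g by (simp add: field_homs_one)
  then show ?case using zero insert.prems by auto
qed simp

section \<open>Algebraic numbers and integers\<close>

text \<open>The leading coefficient \<open>a\<close> of an integer polynomial with root
  \<open>x\<close> serves as \<open>N\<close>: rescaling the variable by \<open>a\<close> makes the
  polynomial monic.\<close>

lemma algebraic_int_multiple:
  fixes x :: "'f::field_char_0"
  assumes "algebraic x"
  obtains N :: int where "N \<noteq> 0" "algebraic_int (of_int N * x)"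
proof -
  from assms obtain p :: "int poly" where p: "p \<noteq> 0" "poly (map_poly of_int p) x = 0"
    by (erule algebraicE')
  define n where "n = degree p"
  define a where "a = lead_coeff p"
  have a: "a \<noteq> 0" using p by (simp add: a_def)
  have "n \<noteq> 0"
  proof
    assume "n = 0"
    then obtain c where "p = [:c:]" unfolding n_def by (meson degree_eq_zeroE)
    then show False using p by (simp add: map_poly_pCons)
  qed
  \<comment> \<open>This is \<open>a ^ (n - 1)\<close> times \<open>p\<close> evaluated at X / a, so
    \<open>q\<close> at \<open>a * x\<close> equals \<open>a ^ (n - 1)\<close> times
    \<open>p\<close> at \<open>x\<close>.\<close>
  define q :: "int poly" where "q = monom 1 n + (\<Sum>i<n. monom (coeff p i * a ^ (n - 1 - i)) i)"
  have deg: "degree (\<Sum>i<n. monom (coeff p i * a ^ (n - 1 - i)) i) < n"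
    using \<open>n \<noteq> 0\<close> by (intro degree_sum_less) (auto intro: le_less_trans[OF degree_monom_le])
  have cq: "coeff q n = 1" "degree q = n"
    using deg by (simp_all add: q_def coeff_eq_0 degree_monom_eq degree_add_eq_left)
  have "poly (map_poly of_int q) (of_int a * x) =
      (of_int a * x) ^ n + (\<Sum>i<n. of_int (coeff p i) * of_int a ^ (n - 1 - i) * (of_int a * x) ^ i)"
  proof -
    have "poly (map_poly of_int q) (of_int a * x) = (\<Sum>i\<le>n. of_int (coeff q i) * (of_int a * x) ^ i)"
      using cq by (subst poly_altdef) (simp add: coeff_map_poly degree_map_poly)
    also have "\<dots> = (of_int a * x) ^ n + (\<Sum>i<n. of_int (coeff q i) * (of_int a * x) ^ i)"
      using cq by (simp flip: lessThan_Suc_atMost)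
    also have "(\<Sum>i<n. of_int (coeff q i) * (of_int a * x) ^ i)
       = (\<Sum>i<n. of_int (coeff p i) * of_int a ^ (n - 1 - i) * (of_int a * x) ^ i)"
      by (intro sum.cong refl) (simp add: q_def coeff_sum)
    finally show ?thesis .
  qed
  also have "\<dots> = of_int a ^ (n - 1) * (of_int a * x ^ n + (\<Sum>i<n. of_int (coeff p i) * x ^ i))"
    unfolding distrib_left sum_distrib_left
  proof (intro arg_cong2[where f = "(+)"] sum.cong refl)
    show "(of_int a * x) ^ n = of_int a ^ (n - 1) * (of_int a * x ^ n)"
      using \<open>n \<noteq> 0\<close> by (simp add: power_mult_distrib mult.assoc[symmetric] flip: power_Suc2)
  next
    fix i assume "i \<in> {..<n}"
    then have "(of_int a :: 'f) ^ (n - 1) = of_int a ^ (n - 1 - i) * of_int a ^ i"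
      by (simp flip: power_add)
    then show "of_int (coeff p i) * of_int a ^ (n - 1 - i) * (of_int a * x) ^ i =
        of_int a ^ (n - 1) * (of_int (coeff p i) * x ^ i)"
      by (simp add: power_mult_distrib)
  qed
  also have "of_int a * x ^ n + (\<Sum>i<n. of_int (coeff p i) * x ^ i) = poly (map_poly of_int p) x"
    by (subst poly_altdef) (simp add: coeff_map_poly degree_map_poly a_def flip: n_def lessThan_Suc_atMost)
  also have "\<dots> = 0" by (rule p)
  finally have "poly (map_poly of_int q) (of_int a * x) = 0" by simp
  then have "algebraic_int (of_int a * x)"
    unfolding algebraic_int_altdef_ipoly using cq by auto
  with a that show ?thesis by blast
qed

text \<open>If the powers of \<open>x\<close> up to \<open>card B\<close> are distinct, they are too
  many to be independent, and a dependence is a polynomial with root \<open>x\<close>. If two of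
  them coincide, their difference is such a polynomial.\<close>

lemma algebraic_of_finite_span:
  fixes x :: "'f::field_char_0"
  assumes "finite B" "rat_vs.span B = (UNIV :: 'f set)"
  shows "algebraic x"
proof (cases "inj_on (\<lambda>k. x ^ k) {..card B}")
  case True
  let ?S = "(\<lambda>k. x ^ k) ` {..card B}"
  have "card ?S = Suc (card B)" using True by (simp add: card_image)
  then have "rat_vs.dependent ?S"
    using rat_vs.independent_span_bound[OF assms(1), of ?S] assms(2) by auto
  then obtain u where u: "\<exists>v\<in>?S. u v \<noteq> 0" "(\<Sum>v\<in>?S. rat_scale (u v) v) = 0"
    by (subst (asm) rat_vs.dependent_finite) auto
  define p :: "'f poly" where "p = (\<Sum>k\<le>card B. monom (of_rat (u (x ^ k))) k)"
  have c: "coeff p i = (if i \<le> card B then of_rat (u (x ^ i)) else 0)" for i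
    by (simp add: p_def coeff_sum)
  show ?thesis
  proof (rule algebraicI')
    show "coeff p i \<in> \<rat>" for i by (simp add: c)
    show "p \<noteq> 0" using u(1) c by (metis (no_types, lifting) atMost_iff coeff_0 image_iff of_rat_eq_0_iff)
    show "poly p x = 0"
      using u(2) True by (simp add: p_def poly_sum poly_monom sum.reindex rat_scale_def)
  qed
next
  case False
  then obtain i j where ij: "i \<noteq> j" "x ^ i = x ^ j" by (auto simp: inj_on_def)
  show ?thesis
  proof (rule algebraicI)
    show "coeff (monom 1 i - monom 1 j :: 'f poly) k \<in> \<int>" for k by simp
    have "coeff (monom 1 i - monom 1 j :: 'f poly) i = 1" using ij by simp
    then show "monom 1 i - monom 1 j \<noteq> (0 :: 'f poly)" by force
    show "poly (monom 1 i - monom 1 j) x = 0" using ij by (simp add: poly_monom)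
  qed
qed

section \<open>Integral bases and their real coordinates\<close>

text \<open>The \<open>\<omega> i\<close> form a basis of the field over the rationals consisting of
  integers; they may span only a subgroup of finite index in the ring of integers, which affects
  only constants depending on the field. \<open>coords\<close> gives real coordinates with respect
  to their images.\<close>

locale integral_basis =
  fixes \<sigma> :: "'n::finite \<Rightarrow> 'f::field_char_0 \<Rightarrow> real"
    and \<omega> :: "'n \<Rightarrow> 'f"
    and coords :: "real ^ 'n \<Rightarrow> real ^ 'n"
  assumes hom: "\<sigma> j \<in> field_homs"
    and integral: "\<omega> i \<in> ring_of_integers"
    and spans: "\<exists>q :: 'n \<Rightarrow> rat. x = (\<Sum>i\<in>UNIV. of_rat (q i) * \<omega> i)"
    and linear_coords: "linear coords"
    and coords_basis: "coords (real_embedding \<sigma> (\<omega> i)) = axis i 1"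
    and coords_expand: "(\<Sum>i\<in>UNIV. coords y $ i *\<^sub>R real_embedding \<sigma> (\<omega> i)) = y"

text \<open>A rational basis is scaled to integers. The matrix of all
  \<open>\<sigma> j (\<omega> i)\<close> is invertible, since a kernel vector of its transpose would
  be a linear relation between the distinct embeddings; its inverse is
  \<open>coords\<close>.\<close>

lemma integral_basis_exists:
  fixes \<sigma> :: "'n::finite \<Rightarrow> 'f::field_char_0 \<Rightarrow> real"
  assumes deg: "field_degree TYPE('f) = CARD('n)" and inj: "inj \<sigma>" and hom: "\<And>j. \<sigma> j \<in> field_homs"
  shows "\<exists>\<omega> coords. integral_basis \<sigma> \<omega> coords"
proof -
  obtain B :: "'f set" where B: "rat_vs.independent B" "rat_vs.span B = UNIV" "card B = CARD('n)"
    using rat_vs.basis_exists[of "UNIV :: 'f set"] deg unfolding field_degree_def by (metis top.extremum_uniqueI)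
  have fin: "finite B" using B(3) by (metis card.infinite zero_less_card_finite less_numeral_extra(3))
  then obtain \<beta> :: "'n \<Rightarrow> 'f" where \<beta>: "bij_betw \<beta> UNIV B"
    using B(3) by (metis finite_same_card_bij finite)
  have "\<exists>N :: int. N \<noteq> 0 \<and> algebraic_int (of_int N * \<beta> i)" for i
    using algebraic_int_multiple[OF algebraic_of_finite_span[OF fin B(2)]] by metis
  then obtain N :: "'n \<Rightarrow> int" where N: "\<And>i. N i \<noteq> 0" "\<And>i. algebraic_int (of_int (N i) * \<beta> i)"
    by metis
  define \<omega> where "\<omega> i = of_int (N i) * \<beta> i" for i
  have span: "\<exists>q :: 'n \<Rightarrow> rat. x = (\<Sum>i\<in>UNIV. of_rat (q i) * \<omega> i)" for x
  proof -
    have "x \<in> rat_vs.span B" using B by simp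
    then obtain u where u: "x = (\<Sum>v\<in>B. rat_scale (u v) v)"
      using rat_vs.span_finite[OF fin] by auto
    also have "\<dots> = (\<Sum>i\<in>UNIV. rat_scale (u (\<beta> i)) (\<beta> i))"
      using sum.reindex_bij_betw[OF \<beta>, of "\<lambda>v. rat_scale (u v) v"] by simp
    also have "\<dots> = (\<Sum>i\<in>UNIV. of_rat (u (\<beta> i) / of_int (N i)) * \<omega> i)"
      by (intro sum.cong refl) (use N in \<open>simp add: \<omega>_def rat_scale_def of_rat_divide\<close>)
    finally show ?thesis by (intro exI[of _ "\<lambda>i. u (\<beta> i) / of_int (N i)"])
  qed
  define A :: "real ^ 'n ^ 'n" where "A = (\<chi> j i. \<sigma> j (\<omega> i))"
  have "\<forall>c. transpose A *v c = 0 \<longrightarrow> c = 0"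
  proof (intro allI impI)
    fix c :: "real ^ 'n" assume c: "transpose A *v c = 0"
    have row: "(\<Sum>j\<in>UNIV. \<sigma> j (\<omega> i) * c $ j) = 0" for i
      using arg_cong[OF c, of "\<lambda>v. v $ i"] by (simp add: matrix_vector_mult_def transpose_def A_def)
    have all: "(\<Sum>j\<in>UNIV. c $ j * \<sigma> j x) = 0" for x
    proof -
      obtain q where q: "x = (\<Sum>i\<in>UNIV. of_rat (q i) * \<omega> i)" using span by blast
      have "(\<Sum>j\<in>UNIV. c $ j * \<sigma> j x) = (\<Sum>j\<in>UNIV. \<Sum>i\<in>UNIV. of_rat (q i) * (\<sigma> j (\<omega> i) * c $ j))"
        by (simp add: q field_homs_sum[OF hom] field_homs_mult[OF hom] field_homs_of_rat[OF hom]
            sum_distrib_left mult_ac)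
      also have "\<dots> = (\<Sum>i\<in>UNIV. of_rat (q i) * (\<Sum>j\<in>UNIV. \<sigma> j (\<omega> i) * c $ j))"
        by (subst sum.swap) (simp add: sum_distrib_left)
      finally show ?thesis by (simp add: row)
    qed
    have "c $ j = 0" for j
    proof -
      \<comment> \<open>Independence concerns sets of homomorphisms, so the coefficients are
        reindexed from \<open>'n\<close> to the range of the injective
        \<open>\<sigma>\<close>.\<close>
      have "c $ inv \<sigma> (\<sigma> j) = 0"
      proof (rule field_homs_independent[where H = "range \<sigma>" and c = "\<lambda>h. c $ inv \<sigma> h" and h = "\<sigma> j"])
        show "(\<Sum>h\<in>range \<sigma>. c $ inv \<sigma> h * h x) = 0" for x
          using all[of x] inj by (simp add: sum.reindex)
      qed (use hom in auto)
      then show ?thesis using inj by simp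
    qed
    then show "c = 0" by (simp add: vec_eq_iff)
  qed
  then have "invertible (transpose A)"
    by (simp add: invertible_left_inverse matrix_left_invertible_ker)
  then have "invertible A" using transpose_invertible[of "transpose A"] by simp
  then obtain B where AB: "A ** B = mat 1" "B ** A = mat 1" by (auto simp: invertible_def)
  have col: "A *v axis i 1 = real_embedding \<sigma> (\<omega> i)" for i
    by (simp add: matrix_vector_mul_component vec_eq_iff A_def real_embedding_def inner_axis)
  have "integral_basis \<sigma> \<omega> ((*v) B)"
  proof
    show "\<omega> i \<in> ring_of_integers" for i using N by (simp add: \<omega>_def ring_of_integers_def)
    show "B *v real_embedding \<sigma> (\<omega> i) = axis i 1" for i
      by (simp add: col[symmetric] matrix_vector_mul_assoc AB)
    show "(\<Sum>i\<in>UNIV. (B *v y) $ i *\<^sub>R real_embedding \<sigma> (\<omega> i)) = y" for y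
    proof -
      have "y = A *v (B *v y)" by (simp add: matrix_vector_mul_assoc AB)
      also have "\<dots> = (\<Sum>i\<in>UNIV. (B *v y) $ i *\<^sub>R real_embedding \<sigma> (\<omega> i))"
        by (simp add: matrix_mult_sum vec_eq_iff real_embedding_def A_def column_def)
      finally show ?thesis by simp
    qed
  qed (use hom span in \<open>auto simp: matrix_vector_right_distrib matrix_vector_mult_scaleR\<close>)
  then show ?thesis by blast
qed

lemma real_embedding_nth: "real_embedding \<sigma> x $ j = \<sigma> j x"
  by (simp add: real_embedding_def)

lemma fractional_ideal_uminus:
  assumes "fractional_ideal I" "x \<in> I" shows "- x \<in> I"
proof -
  have "(- 1) * x \<in> I" using assms int_imp_algebraic_int[of "- 1"]
    unfolding fractional_ideal_def ring_of_integers_def by blast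
  then show ?thesis by simp
qed

text \<open>The product of the individual denominators works, as \<open>Z\<close> is stable under
  integer multiples. This is used for the terms of a rational combination and for finitely many
  powers of an integer.\<close>

lemma common_denominator:
  fixes Z :: "'f::field_char_0 set"
  assumes "finite S" "\<And>y. y \<in> S \<Longrightarrow> \<exists>D::int. D \<noteq> 0 \<and> of_int D * y \<in> Z"
    and mult: "\<And>(n::int) z. z \<in> Z \<Longrightarrow> of_int n * z \<in> Z"
  shows "\<exists>D::int. D \<noteq> 0 \<and> (\<forall>y\<in>S. of_int D * y \<in> Z)"
  using assms(1,2)
proof (induction S rule: finite_induct)
  case (insert a S)
  then obtain D :: int where "D \<noteq> 0" "\<forall>y\<in>S. of_int D * y \<in> Z" by auto
  moreover obtain E :: int where "E \<noteq> 0" "of_int E * a \<in> Z" using insert.prems by blast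
  ultimately have "D * E \<noteq> 0 \<and> (\<forall>y\<in>insert a S. of_int (D * E) * y \<in> Z)"
    using mult[of "of_int D * _" E] mult[of "of_int E * a" D] by (auto simp: mult_ac)
  then show ?case by blast
qed (auto intro: exI[of _ 1])

section \<open>Discreteness and covering for embedded fractional ideals\<close>

context integral_basis
begin

abbreviation "emb \<equiv> real_embedding \<sigma>"

lemma emb_eq_0_iff: "emb x = 0 \<longleftrightarrow> x = 0"
  using field_homs_eq_0_iff[OF hom] by (auto simp: vec_eq_iff real_embedding_nth)

lemma emb_diff: "emb (x - y) = emb x - emb y"
  using field_homs_add[OF hom, of _ "x - y" y] by (simp add: vec_eq_iff real_embedding_nth)

text \<open>The powers of \<open>x\<close> lie in \<open>1/D\<close> times the lattice spanned by the basis, for one fixed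
  \<open>D\<close>; if all conjugates of \<open>x\<close> were less than 1 in absolute value, these powers would tend to 0 in that lattice.\<close>

lemma algebraic_int_conjugate_ge_1:
  assumes x: "algebraic_int x" "x \<noteq> 0"
  shows "\<exists>j. \<bar>\<sigma> j x\<bar> \<ge> 1"
proof (rule ccontr)
  assume "\<not> (\<exists>j. \<bar>\<sigma> j x\<bar> \<ge> 1)"
  then have small: "\<bar>\<sigma> j x\<bar> < 1" for j by (simp add: not_le)
  \<comment> \<open>\<open>Z\<close> need not be closed under products, so powers of
    \<open>x\<close> are only brought into it by a denominator.\<close>
  define Z where "Z = range (\<lambda>n :: 'n \<Rightarrow> int. \<Sum>i\<in>UNIV. of_int (n i) * \<omega> i)"
  have Z0: "0 \<in> Z" unfolding Z_def by (rule image_eqI[of _ _ "\<lambda>_. 0"]) auto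
  have Zadd: "y + z \<in> Z" if yz: "y \<in> Z" "z \<in> Z" for y z
  proof -
    obtain m n where "y = (\<Sum>i\<in>UNIV. of_int (m i) * \<omega> i)" "z = (\<Sum>i\<in>UNIV. of_int (n i) * \<omega> i)"
      using yz by (auto simp: Z_def)
    then show ?thesis unfolding Z_def
      by (intro image_eqI[of _ _ "\<lambda>i. m i + n i"]) (auto simp: sum.distrib algebra_simps)
  qed
  have Zmult: "of_int k * z \<in> Z" if z: "z \<in> Z" for k z
  proof -
    obtain n where "z = (\<Sum>i\<in>UNIV. of_int (n i) * \<omega> i)" using z by (auto simp: Z_def)
    then show ?thesis unfolding Z_def
      by (intro image_eqI[of _ _ "\<lambda>i. k * n i"]) (auto simp: sum_distrib_left algebra_simps)
  qed
  have Zsum: "sum g S \<in> Z" if "\<And>s. s \<in> S \<Longrightarrow> g s \<in> Z" for g :: "'s \<Rightarrow> 'f" and S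
    using that by (induction S rule: infinite_finite_induct) (auto simp: Z0 Zadd)
  have \<omega>Z: "\<omega> i \<in> Z" for i
    unfolding Z_def
    by (rule image_eqI[of _ _ "\<lambda>k. if k = i then 1 else 0"])
      (simp_all add: if_distrib[of of_int] if_distrib[of "\<lambda>c. c * _"] cong: if_cong)
  have denom: "\<exists>D::int. D \<noteq> 0 \<and> of_int D * y \<in> Z" for y
  proof -
    obtain q where q: "y = (\<Sum>i\<in>UNIV. of_rat (q i) * \<omega> i)" using spans by blast
    have "\<exists>D::int. D \<noteq> 0 \<and> (\<forall>y\<in>range (\<lambda>i. of_rat (q i) * \<omega> i). of_int D * y \<in> Z)"
    proof (rule common_denominator)
      fix y assume "y \<in> range (\<lambda>i. of_rat (q i) * \<omega> i)"
      then obtain i where y: "y = of_rat (q i) * \<omega> i" by blast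
      obtain a b where ab: "q i = Rat.Fract a b" "b > 0" by (cases "q i") auto
      have "of_int b * y = of_int a * \<omega> i" using ab by (simp add: y of_rat_rat)
      then show "\<exists>D::int. D \<noteq> 0 \<and> of_int D * y \<in> Z" using ab Zmult[OF \<omega>Z] by (metis less_irrefl)
    qed (use Zmult in auto)
    then show ?thesis unfolding q by (auto simp: sum_distrib_left intro!: Zsum)
  qed
  obtain p where p: "poly (map_poly of_int p) x = 0" "lead_coeff p = 1"
    using x by (auto simp: algebraic_int_altdef_ipoly)
  define m where "m = degree p"
  \<comment> \<open>As \<open>p\<close> is monic, \<open>x ^ m\<close> is an integer combination of
    lower powers. Hence a \<open>D\<close> that clears the denominators of \<open>x ^ e\<close> for
    \<open>e < m\<close> does so for every power.\<close>
  have xm: "x ^ m = - (\<Sum>e<m. of_int (coeff p e) * x ^ e)"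
    using p by (subst (asm) poly_altdef)
      (simp add: coeff_map_poly degree_map_poly eq_neg_iff_add_eq_0 add.commute flip: m_def lessThan_Suc_atMost)
  obtain D :: int where D: "D \<noteq> 0" "\<And>e. e < m \<Longrightarrow> of_int D * x ^ e \<in> Z"
    using common_denominator[of "(\<lambda>e. x ^ e) ` {..<m}" Z] denom Zmult by auto
  have pow: "of_int D * x ^ k \<in> Z" for k
  proof (induction k rule: less_induct)
    case (less k)
    show ?case
    proof (cases "k < m")
      case False
      then have "x ^ k = x ^ (k - m) * x ^ m" by (simp flip: power_add)
      then have "of_int D * x ^ k = (\<Sum>e<m. of_int (- coeff p e) * (of_int D * x ^ (k - m + e)))"
        by (simp add: xm sum_distrib_left power_add sum_negf mult_ac)
      also have "\<dots> \<in> Z"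
        by (intro Zsum Zmult less.IH) (use False in auto)
      finally show ?thesis .
    qed (use D in auto)
  qed
  have "(\<lambda>k. emb (of_int D * x ^ k)) \<longlonglongrightarrow> 0"
  proof (rule vec_tendstoI)
    fix j
    have "(\<lambda>k. of_int D * \<sigma> j x ^ k) \<longlonglongrightarrow> of_int D * 0"
      by (intro tendsto_intros LIMSEQ_power_zero) (use small in auto)
    then show "(\<lambda>k. emb (of_int D * x ^ k) $ j) \<longlonglongrightarrow> 0 $ j"
      by (simp add: real_embedding_nth field_homs_mult[OF hom] field_homs_of_int[OF hom] field_homs_power[OF hom])
  qed
  then have "(\<lambda>k. coords (emb (of_int D * x ^ k))) \<longlonglongrightarrow> coords 0"
    using linear_continuous_at[OF linear_coords[unfolded linear_conv_bounded_linear]]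
    by (rule isCont_tendsto_compose[rotated])
  then have "(\<lambda>k. norm (coords (emb (of_int D * x ^ k)))) \<longlonglongrightarrow> 0"
    using linear_0[OF linear_coords] tendsto_norm_zero by auto
  then have "\<forall>\<^sub>F k in sequentially. norm (coords (emb (of_int D * x ^ k))) < 1"
    by (rule order_tendstoD) simp
  then obtain k where k: "norm (coords (emb (of_int D * x ^ k))) < 1"
    by (auto simp: eventually_sequentially)
  obtain n :: "'n \<Rightarrow> int" where n: "of_int D * x ^ k = (\<Sum>i\<in>UNIV. of_int (n i) * \<omega> i)"
    using pow[of k] by (auto simp: Z_def)
  \<comment> \<open>For a point of \<open>Z\<close>, \<open>coords\<close> returns its integer
    coefficients; a norm below 1 forces them all to be 0, although \<open>of_int D * x ^ k\<close>
    is nonzero.\<close>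
  have "emb (of_int D * x ^ k) = (\<Sum>i\<in>UNIV. of_int (n i) *\<^sub>R emb (\<omega> i))"
    by (simp add: n vec_eq_iff real_embedding_nth field_homs_sum[OF hom] field_homs_mult[OF hom]
        field_homs_of_int[OF hom])
  then have "coords (emb (of_int D * x ^ k)) = (\<Sum>i\<in>UNIV. of_int (n i) *\<^sub>R axis i 1)"
    by (simp add: linear_sum[OF linear_coords] linear_cmul[OF linear_coords] coords_basis)
  then have "coords (emb (of_int D * x ^ k)) $ i = of_int (n i)" for i
    by (simp add: axis_def if_distrib[of "\<lambda>c. _ * c"] cong: if_cong)
  then have "\<bar>of_int (n i) :: real\<bar> < 1" for i
    using k component_le_norm_cart[of "coords (emb (of_int D * x ^ k))" i] by simp
  then have "n i = 0" for i by (metis of_int_less_1_iff of_int_abs zabs_less_one_iff)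
  then have "of_int D * x ^ k = 0" by (simp add: n)
  then show False using D x by simp
qed

text \<open>For a denominator \<open>c\<close> of the ideal, \<open>c * x\<close> is a nonzero
  algebraic integer and so has a conjugate of size at least 1. This gives the gap
  \<open>inverse (norm (emb c))\<close>.\<close>

lemma fractional_ideal_separated:
  assumes "fractional_ideal I"
  obtains \<epsilon> where "\<epsilon> > 0" "\<And>x. x \<in> I \<Longrightarrow> x \<noteq> 0 \<Longrightarrow> \<epsilon> \<le> norm (emb x)"
proof -
  obtain c where c: "c \<noteq> 0" "\<And>x. x \<in> I \<Longrightarrow> algebraic_int (c * x)"
    using assms unfolding fractional_ideal_def ring_of_integers_def by blast
  have pos: "norm (emb c) > 0" using c by (simp add: emb_eq_0_iff)
  have "inverse (norm (emb c)) \<le> norm (emb x)" if x: "x \<in> I" "x \<noteq> 0" for x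
  proof -
    obtain j where "1 \<le> \<bar>\<sigma> j (c * x)\<bar>"
      using algebraic_int_conjugate_ge_1[OF c(2)[OF x(1)]] c x by auto
    also have "\<dots> = \<bar>emb c $ j\<bar> * \<bar>emb x $ j\<bar>"
      by (simp add: real_embedding_nth field_homs_mult[OF hom] abs_mult)
    also have "\<dots> \<le> norm (emb c) * norm (emb x)"
      by (intro mult_mono component_le_norm_cart) auto
    finally show ?thesis using pos by (simp add: field_simps)
  qed
  with pos that[of "inverse (norm (emb c))"] show ?thesis by simp
qed

text \<open>Dividing \<open>y\<close> by \<open>b\<close> in each coordinate reduces the problem to
  rounding down coordinates with respect to the \<open>\<omega> i\<close>. The fractional parts left
  over lie in [0, 1), and multiplying back by \<open>b\<close> scales the error in coordinate
  \<open>j\<close> by \<open>\<sigma> j b\<close>.\<close>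

lemma fractional_ideal_covering:
  assumes I: "fractional_ideal I" and b: "b \<in> I" "b \<noteq> 0"
  shows "\<exists>\<beta>\<in>I. \<forall>j. \<bar>(y - emb \<beta>) $ j\<bar> \<le> (\<Sum>i\<in>UNIV. norm (emb (\<omega> i))) * \<bar>\<sigma> j b\<bar>"
proof -
  have sum: "sum g S \<in> I" if "\<And>s. s \<in> S \<Longrightarrow> g s \<in> I" for g :: "'n \<Rightarrow> 'f" and S
    using that I by (induction S rule: infinite_finite_induct) (auto simp: fractional_ideal_def)
  define z where "z = (\<chi> j. y $ j / \<sigma> j b)"
  define t where "t = coords z"
  define \<beta> where "\<beta> = (\<Sum>i\<in>UNIV. of_int \<lfloor>t $ i\<rfloor> * (\<omega> i * b))"
  have "\<beta> \<in> I" unfolding \<beta>_def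
  proof (rule sum)
    fix i
    have "of_int \<lfloor>t $ i\<rfloor> \<in> (ring_of_integers :: 'f set)"
      by (simp add: ring_of_integers_def int_imp_algebraic_int)
    then show "of_int \<lfloor>t $ i\<rfloor> * (\<omega> i * b) \<in> I"
      using I b integral unfolding fractional_ideal_def by blast
  qed
  moreover have "\<bar>(y - emb \<beta>) $ j\<bar> \<le> (\<Sum>i\<in>UNIV. norm (emb (\<omega> i))) * \<bar>\<sigma> j b\<bar>" for j
  proof -
    have "z $ j = (\<Sum>i\<in>UNIV. t $ i * \<sigma> j (\<omega> i))"
      using arg_cong[OF coords_expand[of z], of "\<lambda>v. v $ j"] by (simp add: t_def real_embedding_nth)
    moreover have "y $ j = z $ j * \<sigma> j b"
      using b field_homs_eq_0_iff[OF hom] by (simp add: z_def)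
    moreover have "\<sigma> j \<beta> = (\<Sum>i\<in>UNIV. of_int \<lfloor>t $ i\<rfloor> * \<sigma> j (\<omega> i)) * \<sigma> j b"
      by (simp add: \<beta>_def field_homs_sum[OF hom] field_homs_mult[OF hom]
          field_homs_of_int[OF hom] sum_distrib_right mult.assoc)
    ultimately have "(y - emb \<beta>) $ j = (\<Sum>i\<in>UNIV. frac (t $ i) * \<sigma> j (\<omega> i)) * \<sigma> j b"
      by (simp add: real_embedding_nth frac_def left_diff_distrib sum_subtractf)
    moreover have "\<bar>\<Sum>i\<in>UNIV. frac (t $ i) * \<sigma> j (\<omega> i)\<bar> \<le> (\<Sum>i\<in>UNIV. norm (emb (\<omega> i)))"
    proof (rule sum_abs[THEN order_trans], rule sum_mono)
      fix i
      have "\<bar>frac (t $ i) * \<sigma> j (\<omega> i)\<bar> \<le> 1 * \<bar>emb (\<omega> i) $ j\<bar>"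
        unfolding abs_mult real_embedding_nth
        using frac_lt_1[of "t $ i"] frac_ge_0[of "t $ i"] by (intro mult_right_mono) auto
      also have "\<dots> \<le> norm (emb (\<omega> i))" using component_le_norm_cart by simp
      finally show "\<bar>frac (t $ i) * \<sigma> j (\<omega> i)\<bar> \<le> norm (emb (\<omega> i))" .
    qed
    ultimately show ?thesis by (simp add: abs_mult mult_right_mono)
  qed
  ultimately show ?thesis by blast
qed

end

section \<open>Fundamental domains and covolumes\<close>

lemma emeasure_lebesgue_translation:
  fixes a :: "'a::euclidean_space"
  shows "emeasure lebesgue ((+) a ` S) = emeasure lebesgue S"
proof -
  have "(+) a ` S = (\<lambda>x. 1 *\<^sub>R x + a) ` S" by (auto simp: add.commute)
  then show ?thesis by (simp only: emeasure_lebesgue_affine) simp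
qed

section \<open>Discrete subgroups of Euclidean space\<close>

text \<open>Full rank is not part of the locale; it enters later through a covering set of finite
  measure.\<close>

locale discrete_group =
  fixes L :: "(real ^ 'n) set" and \<epsilon> :: real
  assumes zero: "0 \<in> L" and diff: "b \<in> L \<Longrightarrow> c \<in> L \<Longrightarrow> b - c \<in> L"
    and \<epsilon>_pos: "\<epsilon> > 0" and separated: "b \<in> L \<Longrightarrow> b \<noteq> 0 \<Longrightarrow> \<epsilon> \<le> norm b"
begin

lemma uminus: "b \<in> L \<Longrightarrow> - b \<in> L"
  using diff[OF zero] by simp

lemma add: "b \<in> L \<Longrightarrow> c \<in> L \<Longrightarrow> b + c \<in> L"
  using diff[of b "- c"] uminus by simp

lemma uniform_discrete: "uniform_discrete L"
  unfolding uniform_discrete_def dist_norm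
  by (metis \<epsilon>_pos separated diff eq_iff_diff_eq_0 not_le)

lemma countable: "countable L"
proof -
  have "L = (\<Union>n::nat. L \<inter> cball 0 (real n))"
    by (auto simp: real_arch_simple)
  moreover have "finite (L \<inter> cball 0 (real n))" for n
    using uniform_discrete uniform_discrete_finite_iff
    by (metis bounded_Int bounded_cball inf_le1 uniform_discrete_subset)
  ultimately show ?thesis by (metis countable_UN countable_finite countableI_type)
qed

text \<open>The balls \<open>U n\<close> of radius \<open>\<epsilon> / 2\<close> around a dense
  sequence cover the space, and \<open>V n\<close> is the union of all translates of
  \<open>U n\<close> by \<open>L\<close>. Each class modulo \<open>L\<close> is represented in the
  first \<open>U n\<close> that it meets, and only once, because two equivalent points of one
  \<open>U n\<close> are less than \<open>\<epsilon>\<close> apart.\<close>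

lemma fundamental_domain_exists: "\<exists>P. fundamental_domain L P"
proof -
  obtain D :: "(real ^ 'n) set" where D: "Countable_Set.countable D"
      "\<And>X. open X \<Longrightarrow> X \<noteq> {} \<Longrightarrow> \<exists>d\<in>D. d \<in> X"
    using countable_dense_exists by blast
  have "D \<noteq> {}" using D(2)[of UNIV] by auto
  define U where "U n = ball (from_nat_into D n) (\<epsilon> / 2)" for n
  define V where "V n = (\<Union>b\<in>L. (+) b ` U n)" for n
  define P where "P = (\<Union>n. U n - (\<Union>m<n. V m))"
  have VI: "b + u \<in> V n" if "b \<in> L" "u \<in> U n" for b u n using that by (auto simp: V_def)
  have "open (V n)" for n
    unfolding V_def U_def by (intro open_UN ballI open_translation) auto
  moreover have "open (U n)" for n by (simp add: U_def)
  ultimately have "P \<in> sets borel" unfolding P_def by measurable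
  moreover have "\<exists>!b. b \<in> L \<and> x - b \<in> P" for x
  proof (rule ex_ex1I)
    obtain d where d: "d \<in> D" "d \<in> ball x (\<epsilon> / 2)"
      using D(2)[of "ball x (\<epsilon> / 2)"] \<epsilon>_pos by auto
    then obtain n where "x \<in> U n"
      unfolding U_def using from_nat_into_surj[OF D(1)] by (metis dist_commute mem_ball)
    then have "x \<in> V n" using VI[OF zero] by fastforce
    define N where "N = (LEAST n. x \<in> V n)"
    have "x \<in> V N" unfolding N_def using \<open>x \<in> V n\<close> by (rule LeastI)
    then obtain b u where bu: "b \<in> L" "u \<in> U N" "x = b + u" by (auto simp: V_def)
    have "u \<notin> V m" if "m < N" for m
    proof
      assume "u \<in> V m"
      then obtain b' u' where "b' \<in> L" "u' \<in> U m" "u = b' + u'" by (auto simp: V_def)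
      then have "x \<in> V m" using bu VI[OF add[of b b'], of u' m] by (simp add: add.assoc)
      then show False using that not_less_Least unfolding N_def by blast
    qed
    then have "x - b \<in> P" using bu by (auto simp: P_def)
    then show "\<exists>b. b \<in> L \<and> x - b \<in> P" using bu by blast
  next
    fix b c assume b: "b \<in> L \<and> x - b \<in> P" and c: "c \<in> L \<and> x - c \<in> P"
    obtain n where n: "x - b \<in> U n" "\<And>m. m < n \<Longrightarrow> x - b \<notin> V m"
      using b by (auto simp: P_def)
    obtain k where k: "x - c \<in> U k" "\<And>m. m < k \<Longrightarrow> x - c \<notin> V m"
      using c by (auto simp: P_def)
    have "x - c \<in> V n" using VI[OF diff[of b c] n(1)] b c by simp
    moreover have "x - b \<in> V k" using VI[OF diff[of c b] k(1)] b c by simp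
    ultimately have "n = k" using n(2) k(2) by (meson linorder_neqE_nat)
    then have "dist (x - b) (x - c) < \<epsilon>"
      using n(1) k(1) unfolding U_def mem_ball by (metis dist_commute dist_triangle_half_r)
    then have "norm (c - b) < \<epsilon>" by (simp add: dist_norm)
    then show "b = c" using separated[of "c - b"] diff b c by force
  qed
  ultimately show ?thesis unfolding fundamental_domain_def
    by (metis sets_completionI_sets sets_lborel)
qed

text \<open>The countably many translates of \<open>P\<close> cover the space, so \<open>P\<close>
  cannot be a null set.\<close>

lemma emeasure_fundamental_domain_pos:
  assumes P: "fundamental_domain L P"
  shows "emeasure lebesgue P > 0"
proof (rule ccontr)
  assume "\<not> emeasure lebesgue P > 0"
  then have "emeasure lebesgue ((+) b ` P) = 0" for b
    by (simp only: emeasure_lebesgue_translation not_less le_zero_eq)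
  moreover have "(+) b ` P \<in> sets lebesgue" for b
    using P by (intro lebesgue_sets_translation) (simp add: fundamental_domain_def)
  ultimately have "(\<Union>b\<in>L. (+) b ` P) \<in> null_sets lebesgue"
    by (intro null_sets_UN' countable null_setsI)
  moreover have "(\<Union>b\<in>L. (+) b ` P) = UNIV"
  proof -
    have "x \<in> (\<Union>b\<in>L. (+) b ` P)" for x
    proof -
      obtain b where "b \<in> L" "x - b \<in> P" using P unfolding fundamental_domain_def by blast
      then show ?thesis by (intro UN_I[of b] image_eqI[of _ _ "x - b"]) auto
    qed
    then show ?thesis by auto
  qed
  ultimately show False by (simp add: null_sets_def)
qed

text \<open>\<open>P\<close> is cut by the translates of \<open>Q\<close> into pieces
  \<open>f n\<close>. Moved back by \<open>- B n\<close>, they become the pieces \<open>g n\<close>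
  of \<open>Q\<close>, which are disjoint because distinct translates of \<open>P\<close>
  are.\<close>

lemma emeasure_fundamental_domain_le:
  assumes P: "fundamental_domain L P" and Q: "Q \<in> sets lebesgue"
    and cover: "\<And>x. \<exists>b\<in>L. x - b \<in> Q"
  shows "emeasure lebesgue P \<le> emeasure lebesgue Q"
proof -
  \<comment> \<open>\<open>B\<close> enumerates \<open>L\<close> injectively on \<open>N\<close>;
    pieces with index outside \<open>N\<close> are empty, so finite and infinite \<open>L\<close>
    are treated alike.\<close>
  define N where "N = to_nat_on L ` L"
  define B where "B n = from_nat_into L n" for n
  have BN: "B n \<in> L" for n using zero by (auto simp: B_def intro: from_nat_into)
  have Binj: "m = n" if "B m = B n" "m \<in> N" "n \<in> N" for m n
    using that countable by (auto simp: B_def N_def)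
  have Bsurj: "\<exists>n\<in>N. B n = b" if "b \<in> L" for b
    using that countable by (auto simp: B_def N_def)
  define f where "f n = (if n \<in> N then P \<inter> (+) (B n) ` Q else {})" for n
  define g where "g n = (if n \<in> N then (+) (- B n) ` P \<inter> Q else {})" for n
  have Pm: "P \<in> sets lebesgue" using P by (simp add: fundamental_domain_def)
  have f: "f n \<in> sets lebesgue" and g: "g n \<in> sets lebesgue" for n
    using sets.Int[OF Pm lebesgue_sets_translation[OF Q, of "B n"]]
      sets.Int[OF lebesgue_sets_translation[OF Pm, of "- B n"] Q] unfolding f_def g_def by auto
  have fg: "emeasure lebesgue (f n) = emeasure lebesgue (g n)" for n
  proof (cases "n \<in> N")
    case True
    then have "f n = (+) (B n) ` g n"
      unfolding f_def g_def by (simp only: if_True image_Int inj_on_add image_image) simp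
    then show ?thesis by (simp only: emeasure_lebesgue_translation)
  qed (simp add: f_def g_def)
  have "P \<subseteq> (\<Union>n. f n)"
  proof
    fix x assume x: "x \<in> P"
    obtain b where b: "b \<in> L" "x - b \<in> Q" using cover by blast
    obtain n where "n \<in> N" "B n = b" using Bsurj b by blast
    then show "x \<in> (\<Union>n. f n)" using x b
      by (intro UN_I[of n]) (auto simp: f_def image_iff intro!: bexI[of _ "x - b"])
  qed
  then have "emeasure lebesgue P \<le> emeasure lebesgue (\<Union>n. f n)"
    using f by (intro emeasure_mono) auto
  also have "\<dots> \<le> (\<Sum>n. emeasure lebesgue (f n))"
    using f by (intro emeasure_subadditive_countably) auto
  also have "\<dots> = (\<Sum>n. emeasure lebesgue (g n))" by (simp add: fg)
  also have "\<dots> = emeasure lebesgue (\<Union>n. g n)"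
  proof (rule suminf_emeasure)
    show "disjoint_family g"
      unfolding disjoint_family_on_def
    proof (intro ballI impI, rule ccontr)
      fix m n assume mn: "m \<noteq> n" "g m \<inter> g n \<noteq> {}"
      then obtain x where "x \<in> g m" "x \<in> g n" by blast
      moreover have "k \<in> N \<and> x - (- B k) \<in> P" if "x \<in> g k" for k
        using that by (cases "k \<in> N") (auto simp: g_def)
      ultimately have "m \<in> N" "n \<in> N" "x - (- B m) \<in> P" "x - (- B n) \<in> P" by auto
      moreover have "- B m \<in> L" "- B n \<in> L" using BN uminus by auto
      ultimately have "- B m = - B n" using P unfolding fundamental_domain_def by blast
      then show False using Binj mn \<open>m \<in> N\<close> \<open>n \<in> N\<close> by auto
    qed
  qed (use g in auto)
  also have "\<dots> \<le> emeasure lebesgue Q"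
    by (intro emeasure_mono Q) (auto simp: g_def split: if_splits)
  finally show ?thesis .
qed

text \<open>\<open>covolume\<close> is the measure of some fundamental domain, to which the two
  preceding lemmas apply. Since \<open>measure\<close> is 0 on sets of infinite measure, positivity
  also uses the finite bound from \<open>Q\<close>.\<close>

lemma covolume_bounds:
  assumes "Q \<in> lmeasurable" "\<And>x. \<exists>b\<in>L. x - b \<in> Q"
  shows "0 < covolume L" "covolume L \<le> measure lebesgue Q"
proof -
  define P where "P = (SOME P. fundamental_domain L P)"
  have P: "fundamental_domain L P"
    unfolding P_def using fundamental_domain_exists by (rule someI_ex)
  have le: "emeasure lebesgue P \<le> emeasure lebesgue Q"
    using assms by (intro emeasure_fundamental_domain_le P) auto
  moreover have fin: "emeasure lebesgue Q < \<infinity>" using assms(1) fmeasurableD2[of Q lebesgue] by (simp only: infinity_ennreal_def less_top)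
  ultimately have "emeasure lebesgue P < \<infinity>" by (rule le_less_trans)
  then show "0 < covolume L"
    using emeasure_fundamental_domain_pos[OF P]
    by (simp add: covolume_def P_def[symmetric] measure_def enn2real_positive_iff)
  show "covolume L \<le> measure lebesgue Q"
    using enn2real_mono[OF le] fin by (simp add: covolume_def P_def[symmetric] measure_def)
qed

text \<open>Only finitely many points of \<open>L\<close> lie in the ball of radius
  \<open>norm c\<close>, so the \<open>LEAST\<close> in the definition, taken over reals, is a true
  minimum.\<close>

lemma packing_radius_attained:
  assumes "L \<noteq> {0}"
  shows "\<exists>b\<in>L - {0}. norm b = 2 * packing_radius L"
    and "c \<in> L - {0} \<Longrightarrow> 2 * packing_radius L \<le> norm c"
proof -
  obtain c where c: "c \<in> L - {0}" using assms zero by blast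
  let ?S = "(L - {0}) \<inter> cball 0 (norm c)"
  have "finite ?S"
    using uniform_discrete uniform_discrete_finite_iff[of ?S]
    by (meson Diff_subset Int_lower1 bounded_Int bounded_cball order_trans uniform_discrete_subset)
  moreover have "?S \<noteq> {}" using c by auto
  ultimately obtain b where b: "b \<in> ?S" "\<And>x. x \<in> ?S \<Longrightarrow> norm b \<le> norm x"
    by (metis arg_min_if_finite(1) arg_min_least)
  have min: "norm b \<le> norm x" if "x \<in> L - {0}" for x
    using b(1) b(2)[of x] that by (cases "norm x \<le> norm c") auto
  then have "(LEAST v. v \<in> norm ` (L - {0})) = norm b"
    using b(1) by (intro Least_equality) auto
  then have "2 * packing_radius L = norm b" by (simp add: packing_radius_def)
  then show "\<exists>b\<in>L - {0}. norm b = 2 * packing_radius L"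
    and "c \<in> L - {0} \<Longrightarrow> 2 * packing_radius L \<le> norm c" for c
    using b(1) min by auto
qed

lemma packing_radius_pos: "L \<noteq> {0} \<Longrightarrow> packing_radius L > 0"
  using packing_radius_attained(1) by (metis Diff_iff singletonI zero_less_norm_iff
      zero_less_numeral zero_less_mult_pos)

end

section \<open>Covolume and packing radius of fractional ideals\<close>

context integral_basis
begin

lemma discrete_group_emb:
  assumes "fractional_ideal I" shows "\<exists>\<epsilon>. discrete_group (emb ` I) \<epsilon>"
proof -
  obtain \<epsilon> where \<epsilon>: "\<epsilon> > 0" "\<And>x. x \<in> I \<Longrightarrow> x \<noteq> 0 \<Longrightarrow> \<epsilon> \<le> norm (emb x)"
    using fractional_ideal_separated[OF assms] by blast
  have "discrete_group (emb ` I) \<epsilon>"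
  proof
    show "0 \<in> emb ` I" using assms emb_eq_0_iff unfolding fractional_ideal_def by (metis imageI)
    fix b c assume "b \<in> emb ` I" "c \<in> emb ` I"
    then obtain x y where xy: "b = emb x" "c = emb y" "x \<in> I" "y \<in> I" by auto
    then have "x + (- y) \<in> I"
      using assms fractional_ideal_uminus[OF assms] unfolding fractional_ideal_def by blast
    then show "b - c \<in> emb ` I" using xy by (auto simp: emb_diff[symmetric])
  qed (use \<epsilon> emb_eq_0_iff in auto)
  then show ?thesis by blast
qed

lemma emb_image_nontrivial:
  assumes "fractional_ideal I" shows "emb ` I \<noteq> {0}"
proof -
  obtain x where "x \<in> I" "x \<noteq> 0" using assms unfolding fractional_ideal_def by blast
  then show ?thesis using emb_eq_0_iff by blast
qed

lemma covolume_le_packing_radius: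
  shows "\<exists>C>0. \<forall>I. fractional_ideal I \<longrightarrow> 0 < covolume (emb ` I) \<and>
    covolume (emb ` I) \<le> C * packing_radius (emb ` I) ^ CARD('n)"
proof -
  \<comment> \<open>The summand 1 makes \<open>M\<close> visibly positive.\<close>
  define M where "M = 1 + (\<Sum>i\<in>UNIV. norm (emb (\<omega> i)))"
  have M: "M > 0" unfolding M_def by (intro add_pos_nonneg sum_nonneg) auto
  have "0 < covolume (emb ` I) \<and> covolume (emb ` I) \<le> (4 * M) ^ CARD('n) * packing_radius (emb ` I) ^ CARD('n)"
    if I: "fractional_ideal I" for I
  proof -
    obtain \<epsilon> where "discrete_group (emb ` I) \<epsilon>" using discrete_group_emb[OF I] by blast
    then interpret L: discrete_group "emb ` I" \<epsilon> .
    obtain b where b: "b \<in> I" "b \<noteq> 0" "norm (emb b) = 2 * packing_radius (emb ` I)"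
      using L.packing_radius_attained(1)[OF emb_image_nontrivial[OF I]] emb_eq_0_iff by auto
    define v where "v = (\<chi> j. M * \<bar>\<sigma> j b\<bar>)"
    have v: "(- v) $ j \<le> v $ j" for j using M by (simp add: v_def)
    have cov: "\<exists>\<beta>\<in>emb ` I. y - \<beta> \<in> cbox (- v) v" for y
    proof -
      obtain \<beta> where \<beta>: "\<beta> \<in> I"
        "\<And>j. \<bar>(y - emb \<beta>) $ j\<bar> \<le> (\<Sum>i\<in>UNIV. norm (emb (\<omega> i))) * \<bar>\<sigma> j b\<bar>"
        using fractional_ideal_covering[OF I b(1,2)] by blast
      have "\<bar>(y - emb \<beta>) $ j\<bar> \<le> v $ j" for j
        using \<beta>(2)[of j] by (simp add: v_def M_def distrib_right)
      then have "y - emb \<beta> \<in> cbox (- v) v"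
        unfolding mem_box_cart by (metis abs_le_iff minus_le_iff vector_uminus_component)
      then show ?thesis using \<beta>(1) by blast
    qed
    have "measure lebesgue (cbox (- v) v) = (\<Prod>j\<in>UNIV. 2 * M * \<bar>\<sigma> j b\<bar>)"
      using v by (simp add: content_cbox_cart interval_ne_empty_cart v_def mult.assoc)
    \<comment> \<open>Each conjugate of the shortest vector \<open>b\<close> is at most its norm,
      which is twice the packing radius; hence 2 becomes 4.\<close>
    also have "\<dots> \<le> (\<Prod>j\<in>(UNIV::'n set). 4 * M * packing_radius (emb ` I))"
    proof (rule prod_mono)
      fix j
      have "\<bar>\<sigma> j b\<bar> \<le> 2 * packing_radius (emb ` I)"
        using component_le_norm_cart[of "emb b" j] b(3) by (simp add: real_embedding_nth)
      then show "0 \<le> 2 * M * \<bar>\<sigma> j b\<bar> \<and> 2 * M * \<bar>\<sigma> j b\<bar> \<le> 4 * M * packing_radius (emb ` I)"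
        using M by simp
    qed
    also have "\<dots> = (4 * M) ^ CARD('n) * packing_radius (emb ` I) ^ CARD('n)"
      by (simp add: power_mult_distrib)
    finally show ?thesis
      using L.covolume_bounds[OF lmeasurable_cbox cov] by linarith
  qed
  moreover have "(4 * M) ^ CARD('n) > 0" using M by simp
  ultimately show ?thesis by blast
qed

end

section \<open>Comparison of the sum with an integral\<close>

lemma nn_integral_prod_cart:
  fixes f :: "'n::finite \<Rightarrow> real \<Rightarrow> ennreal"
  assumes "\<And>j. f j \<in> borel_measurable borel"
  shows "(\<integral>\<^sup>+x. (\<Prod>j\<in>UNIV. f j (x $ j)) \<partial>lborel) = (\<Prod>j\<in>UNIV. \<integral>\<^sup>+y. f j y \<partial>lborel)"
proof -
  have prod: "(\<Prod>b\<in>(Basis :: (real ^ 'n) set). F b) = (\<Prod>j\<in>UNIV. F (axis j 1))" for F :: "real ^ 'n \<Rightarrow> ennreal"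
    by (simp add: Basis_vec_def UNION_singleton_eq_range prod.reindex axis_eq_axis inj_on_def)
  have "(\<integral>\<^sup>+x. (\<Prod>b\<in>(Basis :: (real ^ 'n) set). f (axis_index b) (x \<bullet> b)) \<partial>lborel)
      = (\<Prod>b\<in>(Basis :: (real ^ 'n) set). \<integral>\<^sup>+y. f (axis_index b) y \<partial>lborel)"
    by (rule nn_integral_lborel_prod) (use assms in auto)
  then show ?thesis by (simp add: prod inner_axis)
qed

lemma emeasure_lborel_box_cart:
  fixes b :: "real ^ 'n"
  assumes "s \<ge> 0"
  shows "emeasure lborel (box (b - (\<chi> j. s)) (b + (\<chi> j. s))) = ennreal ((2 * s) ^ CARD('n))"
proof -
  have prod: "(\<Prod>c\<in>(Basis :: (real ^ 'n) set). F c) = (\<Prod>j\<in>UNIV. F (axis j 1))" for F :: "real ^ 'n \<Rightarrow> real"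
    by (simp add: Basis_vec_def UNION_singleton_eq_range prod.reindex axis_eq_axis inj_on_def)
  have "emeasure lborel (box (b - (\<chi> j. s)) (b + (\<chi> j. s)))
      = ennreal (\<Prod>c\<in>Basis. (b + (\<chi> j. s) - (b - (\<chi> j. s))) \<bullet> c)"
    using assms by (intro emeasure_lborel_box)
      (auto simp: inner_axis inner_diff_left inner_add_left Basis_vec_def)
  also have "\<dots> = ennreal ((2 * s) ^ CARD('n))"
    by (simp only: prod inner_axis) simp
  finally show ?thesis .
qed

lemma nn_integral_powr_tail:
  fixes a t :: real
  assumes a: "a \<ge> 2" and t: "t \<ge> 0"
  shows "(\<integral>\<^sup>+x. ennreal ((1 + \<bar>x\<bar>) powr (- a)) * indicator {x. t \<le> \<bar>x\<bar>} x \<partial>lborel)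
    \<le> ennreal (2 * (1 + t) powr (1 - a))"
proof -
  define g where "g x = ennreal ((1 + \<bar>x\<bar>) powr (- a)) * indicator {t..} x" for x :: real
  have [measurable]: "g \<in> borel_measurable borel" unfolding g_def by measurable
  have "((\<lambda>x. - ((1 + x) powr (1 - a)) / (a - 1)) \<longlongrightarrow> - 0 / (a - 1)) at_top"
  proof (intro tendsto_intros tendsto_neg_powr)
    show "filterlim (\<lambda>x::real. 1 + x) at_top at_top"
      by (rule filterlim_tendsto_add_at_top[OF tendsto_const filterlim_ident])
  qed (use a in auto)
  then have "(\<integral>\<^sup>+x. g x \<partial>lborel) = ennreal (0 - (- ((1 + t) powr (1 - a)) / (a - 1)))"
    unfolding g_def
  proof (intro nn_integral_FTC_atLeast)
    fix x assume "t \<le> x"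
    then show "((\<lambda>x. - ((1 + x) powr (1 - a)) / (a - 1)) has_real_derivative (1 + \<bar>x\<bar>) powr - a) (at x)"
      using t a by (auto intro!: derivative_eq_intros simp: divide_simps) (simp add: algebra_simps)
  qed auto
  also have "\<dots> \<le> ennreal ((1 + t) powr (1 - a))"
    using a by (intro ennreal_leI) (simp add: divide_le_eq mult_le_cancel_left1)
  finally have g: "(\<integral>\<^sup>+x. g x \<partial>lborel) \<le> ennreal ((1 + t) powr (1 - a))" .
  have "(\<integral>\<^sup>+x. ennreal ((1 + \<bar>x\<bar>) powr (- a)) * indicator {x. t \<le> \<bar>x\<bar>} x \<partial>lborel)
      \<le> (\<integral>\<^sup>+x. g x + g (- x) \<partial>lborel)"
    by (intro nn_integral_mono) (auto simp: g_def split: split_indicator)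
  also have "\<dots> = (\<integral>\<^sup>+x. g x \<partial>lborel) + (\<integral>\<^sup>+x. g (- x) \<partial>lborel)"
    by (rule nn_integral_add) auto
  also have "(\<integral>\<^sup>+x. g (- x) \<partial>lborel) = (\<integral>\<^sup>+x. g x \<partial>lborel)"
    using nn_integral_real_affine[of g "- 1" 0] by simp
  also have "(\<integral>\<^sup>+x. g x \<partial>lborel) + (\<integral>\<^sup>+x. g x \<partial>lborel) \<le> ennreal (2 * (1 + t) powr (1 - a))"
    using add_mono[OF g g] by (simp flip: ennreal_plus)
  finally show ?thesis .
qed

section \<open>Packing estimate for finite sums of the weight\<close>

lemma weight_nonneg: "weight l x \<ge> 0"
  by (simp add: weight_def prod_nonneg)

text \<open>In each coordinate, \<open>1 + \<bar>x $ j\<bar>\<close> is at most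
  \<open>(1 + r) * (1 + \<bar>b $ j\<bar>)\<close>; raising to the power
  \<open>- (l $ j) / 2\<close> costs at most \<open>(1 + r) powr (M / 2)\<close>.\<close>

lemma weight_le_weight_near:
  fixes l b x :: "real ^ 'n"
  assumes "r \<ge> 0" "\<And>j. \<bar>x $ j - b $ j\<bar> \<le> r" "\<And>j. 0 \<le> l $ j" "\<And>j. l $ j \<le> M"
  shows "weight l b \<le> (1 + r) powr (real CARD('n) * M / 2) * weight l x"
proof -
  have "weight l b \<le> (\<Prod>j\<in>UNIV. (1 + r) powr (M / 2) * (1 + \<bar>x $ j\<bar>) powr (- (l $ j) / 2))"
    unfolding weight_def
  proof (rule prod_mono, intro conjI)
    fix j
    have "1 + \<bar>x $ j\<bar> \<le> (1 + r) + (1 + r) * \<bar>b $ j\<bar>"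
      using assms(2)[of j] mult_nonneg_nonneg[OF assms(1) abs_ge_zero[of "b $ j"]]
      by (simp only: distrib_right mult_1_left)
    then have le: "1 + \<bar>x $ j\<bar> \<le> (1 + r) * (1 + \<bar>b $ j\<bar>)" by (simp add: distrib_left)
    have "(1 + \<bar>b $ j\<bar>) powr (- (l $ j) / 2)
        = (1 + r) powr (l $ j / 2) * ((1 + r) * (1 + \<bar>b $ j\<bar>)) powr (- (l $ j) / 2)"
      using assms(1) by (simp add: powr_mult mult.assoc[symmetric] flip: powr_add)
    also have "\<dots> \<le> (1 + r) powr (M / 2) * (1 + \<bar>x $ j\<bar>) powr (- (l $ j) / 2)"
      using assms(1,3) assms(4)[of j] le by (intro mult_mono powr_mono powr_mono2') auto
    finally show "(1 + \<bar>b $ j\<bar>) powr (- (l $ j) / 2)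
      \<le> (1 + r) powr (M / 2) * (1 + \<bar>x $ j\<bar>) powr (- (l $ j) / 2)" .
  qed simp
  also have "\<dots> = (1 + r) powr (real CARD('n) * M / 2) * weight l x"
    using assms(1) by (simp add: prod.distrib weight_def powr_power mult_ac)
  finally show ?thesis .
qed

text \<open>In the application \<open>r0\<close> and \<open>r\<close> are the packing radii of the
  larger and the smaller lattice. The bound does not depend on the finite set \<open>S\<close>, so
  it yields summability as well as the estimate of the sum.\<close>

lemma weight_sum_le:
  fixes l :: "real ^ 'n" and S :: "(real ^ 'n) set"
  assumes "finite S" and r0: "0 < r0" "r0 \<le> r"
    and sep: "\<And>b c. b \<in> S \<Longrightarrow> c \<in> S \<Longrightarrow> b \<noteq> c \<Longrightarrow> 2 * r0 \<le> norm (b - c)"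
    and far: "\<And>b. b \<in> S \<Longrightarrow> 2 * r \<le> norm b"
    and l: "m \<ge> 4" "\<And>j. m \<le> l $ j" "\<And>j. l $ j \<le> M"
  defines "d \<equiv> real CARD('n)"
  shows "(\<Sum>b\<in>S. weight l b) \<le> (1 + r0) powr (d * M / 2) * (d * (r / d) powr (1 - m / 2) / (r0 / d) ^ CARD('n))"
proof -
  \<comment> \<open>The norm is at most the sum of the \<open>d\<close> coordinate sizes. So boxes
    of half side \<open>s\<close> around \<open>S\<close> are disjoint, and a vector of norm at
    least \<open>2 * r\<close> has a coordinate of size at least \<open>2 * t\<close>; as
    \<open>s \<le> t\<close>, this coordinate stays at least \<open>t\<close> on the box.\<close>
  define s where "s = r0 / d"
  define t where "t = r / d"
  define W where "W = (1 + r0) powr (d * M / 2)"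
  have d: "d \<ge> 1" unfolding d_def by (simp add: Suc_le_eq)
  have pos: "s > 0" "t > 0" "s \<le> t" "s \<le> r0" "W > 0" using d r0 by (auto simp: s_def t_def W_def field_simps divide_le_eq mult_le_cancel_left1)
  define Bx where "Bx b = box (b - (\<chi> j. s)) (b + (\<chi> j. s))" for b :: "real ^ 'n"
  have Bx: "\<bar>x $ j - b $ j\<bar> < s" if "x \<in> Bx b" for x b j
    using that unfolding Bx_def mem_box_cart by (auto simp: abs_less_iff dest: spec[of _ j])
  have l1_less: "norm x < d * u" if "\<And>j. \<bar>x $ j\<bar> < u" for x :: "real ^ 'n" and u
  proof -
    have "norm x \<le> (\<Sum>j\<in>UNIV. \<bar>x $ j\<bar>)" by (rule norm_le_l1_cart)
    also have "\<dots> < (\<Sum>j\<in>(UNIV::'n set). u)" by (intro sum_strict_mono that) auto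
    finally show ?thesis by (simp add: d_def)
  qed
  have disj: "b = c" if "x \<in> Bx b" "x \<in> Bx c" "b \<in> S" "c \<in> S" for x b c
  proof (rule ccontr)
    assume "b \<noteq> c"
    have "\<bar>(b - c) $ j\<bar> < 2 * s" for j using Bx[OF that(1), of j] Bx[OF that(2), of j] by simp
    then have "norm (b - c) < d * (2 * s)" by (rule l1_less)
    also have "\<dots> = 2 * r0" using d by (simp add: s_def)
    finally show False using sep[OF that(3,4) \<open>b \<noteq> c\<close>] by simp
  qed
  \<comment> \<open>For fixed \<open>k\<close>, the product of the \<open>\<phi> k j\<close> is the
    weight restricted to \<open>t \<le> \<bar>x $ k\<bar>\<close>. Summing over \<open>k\<close>,
    \<open>H\<close> majorises the weight wherever some coordinate has size at least
    \<open>t\<close>, and still integrates coordinate by coordinate.\<close>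
  define \<phi> where "\<phi> k j y = ennreal ((1 + \<bar>y\<bar>) powr (- (l $ j) / 2)) * (if j = k then indicator {y. t \<le> \<bar>y\<bar>} y else 1)"
    for k j and y :: real
  define H where "H x = (\<Sum>k\<in>UNIV. \<Prod>j\<in>UNIV. \<phi> k j (x $ j))" for x
  have \<phi>_meas: "\<phi> k j \<in> borel_measurable borel" for k j
    unfolding \<phi>_def by (cases "j = k") auto
  have prod_meas: "(\<lambda>x. \<Prod>j\<in>UNIV. \<phi> k j (x $ j)) \<in> borel_measurable borel" for k
    by (intro borel_measurable_prod_ennreal measurable_compose[OF _ \<phi>_meas]
        borel_measurable_continuous_onI continuous_intros)
  have H_meas: "H \<in> borel_measurable borel"
    unfolding H_def by (intro borel_measurable_sum prod_meas)
  have ptw: "ennreal (weight l b) \<le> ennreal W * H x" if b: "b \<in> S" and x: "x \<in> Bx b" for b x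
  proof -
    have "\<exists>k. 2 * t \<le> \<bar>b $ k\<bar>"
    proof (rule ccontr)
      assume "\<not> (\<exists>k. 2 * t \<le> \<bar>b $ k\<bar>)"
      then have "norm b < d * (2 * t)" by (intro l1_less) (simp add: not_le)
      also have "\<dots> = 2 * r" using d by (simp add: t_def)
      finally show False using far[OF b] by simp
    qed
    then obtain k where "2 * t \<le> \<bar>b $ k\<bar>" by blast
    then have k: "t \<le> \<bar>x $ k\<bar>" using Bx[OF x, of k] pos by linarith
    have "weight l b \<le> W * weight l x"
      unfolding W_def d_def
    proof (rule weight_le_weight_near)
      show "\<bar>x $ j - b $ j\<bar> \<le> r0" for j using Bx[OF x, of j] pos by linarith
      show "0 \<le> l $ j" for j using l(1) l(2)[of j] by linarith
    qed (use r0 l in auto)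
    then have "ennreal (weight l b) \<le> ennreal W * ennreal (weight l x)"
      using pos by (simp add: ennreal_leI weight_nonneg flip: ennreal_mult)
    also have "ennreal (weight l x) = (\<Prod>j\<in>UNIV. \<phi> k j (x $ j))"
      unfolding weight_def \<phi>_def using k by (subst prod_ennreal[symmetric]) (auto intro!: prod.cong)
    also have "\<dots> \<le> H x" unfolding H_def by (intro member_le_sum) auto
    finally show ?thesis by (simp add: mult_left_mono)
  qed
  \<comment> \<open>Only coordinate \<open>k\<close> contributes decay in \<open>t\<close>; the
    others are integrated over the whole line, as tails from 0. The base \<open>1 + t\<close> may be
    lowered to \<open>t\<close> because the exponent is negative.\<close>
  have \<phi>_int: "(\<integral>\<^sup>+y. \<phi> k j y \<partial>lborel) \<le> ennreal (2 * (if j = k then t powr (1 - m / 2) else 1))" for k j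
  proof (cases "j = k")
    case True
    have "(\<integral>\<^sup>+y. \<phi> k j y \<partial>lborel) \<le> ennreal (2 * (1 + t) powr (1 - l $ j / 2))"
      using nn_integral_powr_tail[of "l $ j / 2" t] l(1) l(2)[of j] pos True by (simp add: \<phi>_def)
    also have "(1 + t) powr (1 - l $ j / 2) \<le> (1 + t) powr (1 - m / 2)"
      using pos l(2)[of j] by (intro powr_mono) auto
    also have "\<dots> \<le> t powr (1 - m / 2)"
      using pos l(1) by (intro powr_mono2') auto
    finally show ?thesis using True by (simp add: ennreal_leI)
  next
    case False
    then show ?thesis
      using nn_integral_powr_tail[of "l $ j / 2" 0] l(1) l(2)[of j] by (simp add: \<phi>_def)
  qed
  have "(\<integral>\<^sup>+x. H x \<partial>lborel) = (\<Sum>k\<in>UNIV. \<Prod>j\<in>UNIV. \<integral>\<^sup>+y. \<phi> k j y \<partial>lborel)"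
    unfolding H_def using prod_meas \<phi>_meas
    by (subst nn_integral_sum) (auto simp: nn_integral_prod_cart)
  also have "\<dots> \<le> (\<Sum>k\<in>(UNIV::'n set). \<Prod>j\<in>UNIV. ennreal (2 * (if j = k then t powr (1 - m / 2) else 1)))"
    by (intro sum_mono prod_mono_ennreal \<phi>_int)
  also have "\<dots> = (\<Sum>k\<in>(UNIV::'n set). ennreal (2 ^ CARD('n) * t powr (1 - m / 2)))"
    by (intro sum.cong refl, subst prod_ennreal) (auto simp: prod.distrib)
  also have "\<dots> = ennreal (d * (2 ^ CARD('n) * t powr (1 - m / 2)))"
    by (subst sum_ennreal) (auto simp: d_def)
  finally have H_int: "(\<integral>\<^sup>+x. H x \<partial>lborel) \<le> ennreal (d * (2 ^ CARD('n) * t powr (1 - m / 2)))" .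
  \<comment> \<open>Each term is spread over its box of volume \<open>(2 * s) ^ CARD('n)\<close>; at
    any point at most one box counts. The power of 2 later cancels against that in
    \<open>H_int\<close>.\<close>
  have "ennreal ((\<Sum>b\<in>S. weight l b) * (2 * s) ^ CARD('n))
      = (\<Sum>b\<in>S. ennreal (weight l b) * emeasure lborel (Bx b))"
    using pos by (simp add: Bx_def emeasure_lborel_box_cart sum_distrib_right sum_nonneg weight_nonneg
        flip: ennreal_mult sum_ennreal)
  also have "\<dots> = (\<integral>\<^sup>+x. (\<Sum>b\<in>S. ennreal (weight l b) * indicator (Bx b) x) \<partial>lborel)"
    by (subst nn_integral_sum) (auto simp: Bx_def nn_integral_cmult_indicator)
  also have "\<dots> \<le> (\<integral>\<^sup>+x. ennreal W * H x \<partial>lborel)"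
  proof (rule nn_integral_mono)
    fix x
    show "(\<Sum>b\<in>S. ennreal (weight l b) * indicator (Bx b) x) \<le> ennreal W * H x"
    proof (cases "\<exists>b\<in>S. x \<in> Bx b")
      case True
      then obtain b where b: "b \<in> S" "x \<in> Bx b" by blast
      have "(\<Sum>c\<in>S. ennreal (weight l c) * indicator (Bx c) x) = (\<Sum>c\<in>S. if c = b then ennreal (weight l b) else 0)"
        using b disj by (intro sum.cong) (auto split: split_indicator)
      then show ?thesis using b ptw \<open>finite S\<close> by simp
    next
      case False
      then have "(\<Sum>b\<in>S. ennreal (weight l b) * indicator (Bx b) x) = 0"
        by (intro sum.neutral) auto
      then show ?thesis by simp
    qed
  qed
  also have "\<dots> = ennreal W * (\<integral>\<^sup>+x. H x \<partial>lborel)"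
    using H_meas by (intro nn_integral_cmult) auto
  also have "\<dots> \<le> ennreal W * ennreal (d * (2 ^ CARD('n) * t powr (1 - m / 2)))"
    by (intro mult_left_mono H_int) auto
  also have "\<dots> = ennreal (W * (d * (2 ^ CARD('n) * t powr (1 - m / 2))))"
    using pos d by (simp add: ennreal_mult)
  finally have "(\<Sum>b\<in>S. weight l b) * (2 * s) ^ CARD('n) \<le> W * (d * (2 ^ CARD('n) * t powr (1 - m / 2)))"
    using pos d by (subst (asm) ennreal_le_iff) auto
  then have "(\<Sum>b\<in>S. weight l b) \<le> W * (d * t powr (1 - m / 2) / s ^ CARD('n))"
    using pos by (simp add: power_mult_distrib field_simps)
  then show ?thesis by (simp add: W_def s_def t_def)
qed

section \<open>The estimate for a pair of fractional ideals\<close>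

theorem theorem9p1:
  fixes \<sigma> :: "'n::{finite,linorder} \<Rightarrow> 'f::field_char_0 \<Rightarrow> real"
    and l :: "real ^ 'n::{finite,linorder}"
  assumes "totally_real TYPE('f)"
    and "field_degree TYPE('f) = CARD('n)"
    and "bij_betw \<sigma> UNIV field_homs"
    and "mono (\<lambda>j. l $ j)"
    and "l $ Min UNIV \<ge> 4"
  shows "\<exists>C>0. \<forall>I I\<^sub>0 :: 'f set. fractional_ideal I \<longrightarrow> fractional_ideal I\<^sub>0 \<longrightarrow> I \<subseteq> I\<^sub>0 \<longrightarrow>
    (let \<Lambda> = real_embedding \<sigma> ` I; \<Lambda>\<^sub>0 = real_embedding \<sigma> ` I\<^sub>0 in
      weight l summable_on (\<Lambda> - {0}) \<and>
      theta l \<Lambda> \<le> C * (1 + packing_radius \<Lambda>\<^sub>0) powr (real CARD('n) * l $ Max UNIV / 2)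
        * inverse (covolume \<Lambda>\<^sub>0)
        * covolume \<Lambda> powr ((1 - l $ Min UNIV / 2) / real CARD('n)))"
proof -
  have inj: "inj \<sigma>" and hom: "\<And>j. \<sigma> j \<in> field_homs"
    using assms(3) by (auto simp: bij_betw_def)
  obtain \<omega> coords where "integral_basis \<sigma> \<omega> coords"
    using integral_basis_exists[OF assms(2) inj hom] by blast
  then interpret integral_basis \<sigma> \<omega> coords .
  obtain C where C: "C > 0" "\<And>I. fractional_ideal I \<Longrightarrow> 0 < covolume (emb ` I)"
      "\<And>I. fractional_ideal I \<Longrightarrow> covolume (emb ` I) \<le> C * packing_radius (emb ` I) ^ CARD('n)"
    using covolume_le_packing_radius by blast
  define d where "d = real CARD('n)"
  define m where "m = l $ Min UNIV"
  define M where "M = l $ Max UNIV"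
  define e where "e = 1 - m / 2"
  have d: "d > 0" by (simp add: d_def)
  have m: "m \<ge> 4" using assms(5) by (simp add: m_def)
  have l: "m \<le> l $ j" "l $ j \<le> M" for j
    using assms(4) by (auto simp: m_def M_def mono_def)
  \<comment> \<open>The powers of \<open>d\<close> come from the half sides in
    \<open>weight_sum_le\<close>. The factor \<open>C\<close> converts the packing radius of the
    larger lattice into its covolume, and \<open>C powr (- e / d)\<close> does so for the smaller
    one.\<close>
  define K where "K = d * d ^ CARD('n) * C * (1 / d) powr e * C powr (- e / d)"
  have "K > 0" using d C(1) by (simp add: K_def)
  moreover have "weight l summable_on (emb ` I - {0}) \<and>
      theta l (emb ` I) \<le> K * (1 + packing_radius (emb ` I\<^sub>0)) powr (d * M / 2)
        * inverse (covolume (emb ` I\<^sub>0)) * covolume (emb ` I) powr (e / d)"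
    if I: "fractional_ideal I" "fractional_ideal I\<^sub>0" "I \<subseteq> I\<^sub>0" for I I\<^sub>0
  proof -
    obtain \<epsilon> \<epsilon>\<^sub>0 where "discrete_group (emb ` I) \<epsilon>" "discrete_group (emb ` I\<^sub>0) \<epsilon>\<^sub>0"
      using discrete_group_emb I by metis
    then interpret L: discrete_group "emb ` I" \<epsilon> + L\<^sub>0: discrete_group "emb ` I\<^sub>0" \<epsilon>\<^sub>0 .
    note nontriv = emb_image_nontrivial[OF I(1)] emb_image_nontrivial[OF I(2)]
    define r where "r = packing_radius (emb ` I)"
    define r\<^sub>0 where "r\<^sub>0 = packing_radius (emb ` I\<^sub>0)"
    have r\<^sub>0: "r\<^sub>0 > 0" using L\<^sub>0.packing_radius_pos nontriv by (simp add: r\<^sub>0_def)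
    have min\<^sub>0: "2 * r\<^sub>0 \<le> norm c" if "c \<in> emb ` I\<^sub>0 - {0}" for c
      using L\<^sub>0.packing_radius_attained(2)[OF nontriv(2) that] by (simp add: r\<^sub>0_def)
    have min: "2 * r \<le> norm c" if "c \<in> emb ` I - {0}" for c
      using L.packing_radius_attained(2)[OF nontriv(1) that] by (simp add: r_def)
    \<comment> \<open>A shortest vector of the smaller lattice also lies in the larger one, so
      \<open>r\<^sub>0 \<le> r\<close>.\<close>
    obtain b where "b \<in> emb ` I - {0}" "norm b = 2 * r"
      using L.packing_radius_attained(1)[OF nontriv(1)] by (auto simp: r_def)
    then have r: "r\<^sub>0 \<le> r" using min\<^sub>0[of b] I(3) by auto
    define B where "B = (1 + r\<^sub>0) powr (d * M / 2) * (d * (r / d) powr e / (r\<^sub>0 / d) ^ CARD('n))"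
    have bound: "(\<Sum>b\<in>S. weight l b) \<le> B" if S: "finite S" "S \<subseteq> emb ` I - {0}" for S
      unfolding B_def d_def e_def
    proof (rule weight_sum_le)
      fix b c assume "b \<in> S" "c \<in> S" "b \<noteq> c"
      moreover have "S \<subseteq> emb ` I\<^sub>0" using S(2) I(3) by blast
      ultimately have "b - c \<in> emb ` I\<^sub>0 - {0}" using L\<^sub>0.diff[of b c] by auto
      then show "2 * r\<^sub>0 \<le> norm (b - c)" by (rule min\<^sub>0)
    qed (use S r\<^sub>0 r min m l in auto)
    have summable: "weight l summable_on (emb ` I - {0})"
      by (rule nonneg_bdd_above_summable_on)
        (auto simp: weight_nonneg intro!: bdd_aboveI[of _ B] bound)
    have "theta l (emb ` I) \<le> B"
      unfolding theta_def using summable bound by (rule infsum_le_finite_sums)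
    also have "B \<le> K * (1 + r\<^sub>0) powr (d * M / 2) * inverse (covolume (emb ` I\<^sub>0)) * covolume (emb ` I) powr (e / d)"
    proof -
      have "1 / r\<^sub>0 ^ CARD('n) \<le> C * inverse (covolume (emb ` I\<^sub>0))"
        using C(2,3)[OF I(2)] r\<^sub>0 by (simp add: r\<^sub>0_def field_simps)
      \<comment> \<open>The exponent \<open>e / d\<close> is negative, so the upper bound for the
        covolume by \<open>C * r ^ CARD('n)\<close> turns into an upper bound for this power of
        \<open>r\<close>.\<close>
      moreover have "r powr e \<le> C powr (- e / d) * covolume (emb ` I) powr (e / d)"
      proof -
        have "r powr e = (r ^ CARD('n)) powr (e / d)"
          using r\<^sub>0 r d by (simp add: powr_powr d_def flip: powr_realpow)
        also have "\<dots> \<le> (covolume (emb ` I) / C) powr (e / d)"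
        proof (rule powr_mono2')
          show "e / d \<le> 0" using m d by (simp add: e_def divide_le_0_iff)
          show "covolume (emb ` I) / C > 0" using C(1) C(2)[OF I(1)] by simp
          show "covolume (emb ` I) / C \<le> r ^ CARD('n)"
            using C(1) C(3)[OF I(1)] by (simp add: r_def divide_le_eq mult.commute)
        qed
        also have "\<dots> = C powr (- e / d) * covolume (emb ` I) powr (e / d)"
          using C(1) C(2)[OF I(1)] by (simp add: powr_divide powr_minus_divide)
        finally show ?thesis .
      qed
      ultimately have "1 / r\<^sub>0 ^ CARD('n) * r powr e
          \<le> (C * inverse (covolume (emb ` I\<^sub>0))) * (C powr (- e / d) * covolume (emb ` I) powr (e / d))"
        using C(1) C(2)[OF I(2)] by (intro mult_mono) auto
      then have "((1 + r\<^sub>0) powr (d * M / 2) * d * d ^ CARD('n) * (1 / d) powr e) * (1 / r\<^sub>0 ^ CARD('n) * r powr e)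
          \<le> ((1 + r\<^sub>0) powr (d * M / 2) * d * d ^ CARD('n) * (1 / d) powr e)
            * ((C * inverse (covolume (emb ` I\<^sub>0))) * (C powr (- e / d) * covolume (emb ` I) powr (e / d)))"
        using d by (intro mult_left_mono) auto
      moreover have "(r / d) powr e = (1 / d) powr e * r powr e"
        using d r r\<^sub>0 by (simp add: powr_divide)
      then have "B = ((1 + r\<^sub>0) powr (d * M / 2) * d * d ^ CARD('n) * (1 / d) powr e) * (1 / r\<^sub>0 ^ CARD('n) * r powr e)"
        by (simp add: B_def power_divide)
      ultimately show ?thesis by (simp add: K_def mult_ac)
    qed
    finally show ?thesis using summable by (simp add: r\<^sub>0_def)
  qed
  ultimately show ?thesis
    unfolding Let_def d_def M_def e_def m_def by blast
qed

end
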